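(* Let $\mathsf{A},\mathsf{B}\in\mathbb{R}^{n\times n}$ be symmetric positive definite, with generalized eigenpairs $(\lambda_i,x_i)$, $i=1,\dots,n$, satisfying $\mathsf{A}x_i=\lambda_i\mathsf{B}x_i$, $x_i^\top\mathsf{B}x_j=\delta_{ij}$, $x_i^\top\mathsf{A}x_j=\lambda_i\delta_{ij}$ and $\lambda_1\ge\cdots\ge\lambda_k>\lambda_{k+1}\ge\cdots\ge\lambda_n>0$, where $1\le k<n$. Let $\mathcal{X}^h=\operatorname{span}\{x_1,\dots,x_k\}$, let $\mathcal{Y}\subset\mathbb{R}^n$ be a $k$-dimensional subspace, let $\mathsf{Y}\in\mathbb{R}^{n\times k}$ have columns forming a $\mathsf{B}$-orthonormal basis of $\mathcal{Y}$, and let $\mathsf{C}^l\in\mathbb{R}^{(n-k)\times k}$ be the lower block of the coefficient matrix of $\mathsf{Y}$ in the basis $x_1,\dots,x_n$ (see context). If $$E(\mathcal{X}^h)-E(\mathcal{Y})\le\frac{\lambda_k-\lambda_{k+1}}{2k},$$ then $$d(\mathcal{Y},\mathcal{X}^h)\le\sqrt{\lambda_{k+1}\,\frac{\|\mathsf{C}^{l\top}\mathsf{C}^l\|}{1-\|\mathsf{C}^{l\top}\mathsf{C}^l\|}},$$ and furthermore $$d(\mathcal{Y},\mathcal{X}^h)\le\sqrt{2\lambda_{k+1}\,\frac{k\left(E(\mathcal{X}^h)-E(\mathcal{Y})\right)}{\lambda_k-\lambda_{k+1}}}.$$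
   Context: For a symmetric positive definite matrix $\mathsf{M}$, $\|v\|_{\mathsf{M}}=\sqrt{v^\top\mathsf{M}v}$. "$\mathsf{B}$-orthonormal" means orthonormal with respect to $\langle u,v\rangle_{\mathsf{B}}=u^\top\mathsf{B}v$. The norm $\|\cdot\|$ of a matrix is the spectral (operator 2-) norm. Energy: for a $k$-dimensional subspace $\mathcal{Z}\subset\mathbb{R}^n$, let $\mathsf{Z}\in\mathbb{R}^{n\times k}$ be any matrix whose columns form a $\mathsf{B}$-orthonormal basis of $\mathcal{Z}$; then $$E(\mathcal{Z})=\frac{\operatorname{Tr}(\mathsf{Z}^\top\mathsf{A}\mathsf{Z})}{\operatorname{Tr}(\mathsf{Z}^\top\mathsf{B}\mathsf{Z})},$$ which does not depend on the choice of $\mathsf{Z}$. Kolmogorov distance: $$d(\mathcal{Y},\mathcal{X}^h)=\sup_{z\in\mathcal{X}^h,\ \|z\|_{\mathsf{B}}\le1}\ \inf_{y\in\mathcal{Y}}\|z-y\|_{\mathsf{A}}.$$ Coefficient matrix: with $\mathsf{X}=[x_1,\dots,x_n]$, write $\mathsf{Y}=\mathsf{X}\mathsf{C}$ with $\mathsf{C}\in\mathbb{R}^{n\times k}$. $\mathsf{C}^h\in\mathbb{R}^{k\times k}$ denotes the first $k$ rows of $\mathsf{C}$ and $\mathsf{C}^l\in\mathbb{R}^{(n-k)\times k}$ the last $n-k$ rows, so that $\mathsf{Y}=[x_1,\dots,x_k]\mathsf{C}^h+[x_{k+1},\dots,x_n]\mathsf{C}^l$. *)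

theory Defs
  imports Complex_Main "Jordan_Normal_Form.VS_Connect"
begin

text \<open>
  Vectors and matrices are those of Jordan_Normal_Form, with explicit dimensions and entries
  indexed from 0.  Families such as the eigenpairs are functions on \<^typ>\<open>nat\<close>
  that are used on the indices \<open>1, \<dots>, n\<close>.
\<close>

abbreviation Rvec :: "nat \<Rightarrow> (real, real vec) module" where
  "Rvec n \<equiv> module_vec TYPE(real) n"

definition is_subspace :: "nat \<Rightarrow> real vec set \<Rightarrow> bool" where
  "is_subspace n W \<longleftrightarrow> VectorSpace.subspace class_ring W (Rvec n)"

definition subspace_dim :: "nat \<Rightarrow> real vec set \<Rightarrow> nat" where
  "subspace_dim n W = vectorspace.dim class_ring (Rvec n\<lparr>carrier := W\<rparr>)"

definition span_vecs :: "nat \<Rightarrow> real vec set \<Rightarrow> real vec set" where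
  "span_vecs n S = LinearCombinations.module.span class_ring (Rvec n) S"

definition spd :: "nat \<Rightarrow> real mat \<Rightarrow> bool" where
  "spd n M \<longleftrightarrow> M \<in> carrier_mat n n \<and> M\<^sup>T = M \<and>
     (\<forall>v \<in> carrier_vec n. v \<noteq> 0\<^sub>v n \<longrightarrow> v \<bullet> (M *\<^sub>v v) > 0)"

definition weighted_norm :: "real mat \<Rightarrow> real vec \<Rightarrow> real" where
  "weighted_norm M v = sqrt (v \<bullet> (M *\<^sub>v v))"

definition euclid_norm :: "real vec \<Rightarrow> real" where
  "euclid_norm v = sqrt (v \<bullet> v)"

definition spectral_norm :: "real mat \<Rightarrow> real" where
  "spectral_norm M =
     (SUP v \<in> {v \<in> carrier_vec (dim_col M). euclid_norm v \<le> 1}. euclid_norm (M *\<^sub>v v))"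

definition mat_trace :: "real mat \<Rightarrow> real" where
  "mat_trace M = (\<Sum>i<dim_row M. M $$ (i, i))"

text \<open>
  The columns of \<open>Z\<close> form a \<open>B\<close>-orthonormal basis of the subspace \<open>W\<close> of real \<open>n\<close>-space.
  Orthonormality is required of the family of columns, so the columns are distinct and the
  number of columns of \<open>Z\<close> is the dimension of \<open>W\<close>.
\<close>

definition orthonormal_basis_mat :: "nat \<Rightarrow> real mat \<Rightarrow> real vec set \<Rightarrow> real mat \<Rightarrow> bool" where
  "orthonormal_basis_mat n B W Z \<longleftrightarrow>
     dim_row Z = n \<and>
     (\<forall>i < dim_col Z. \<forall>j < dim_col Z. col Z i \<bullet> (B *\<^sub>v col Z j) = (if i = j then 1 else 0)) \<and>
     vectorspace.basis class_ring (Rvec n\<lparr>carrier := W\<rparr>) (set (cols Z))"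

text \<open>
  For \<open>B\<close> symmetric positive definite every subspace has such a basis matrix, and the quotient
  below takes the same value for each of them, so the choice made here is immaterial.
\<close>

definition energy :: "nat \<Rightarrow> real mat \<Rightarrow> real mat \<Rightarrow> real vec set \<Rightarrow> real" where
  "energy n A B W =
     (let Z = (SOME Z. orthonormal_basis_mat n B W Z)
      in mat_trace (Z\<^sup>T * A * Z) / mat_trace (Z\<^sup>T * B * Z))"

text \<open>
  For symmetric positive definite \<open>A\<close>, \<open>B\<close> and subspaces \<open>W\<close>, \<open>U\<close> the infimum is over values
  bounded below by 0 and the supremum is over values bounded above, so both real-valued
  operators have their usual meaning.
\<close>

definition kolmogorov_dist ::
  "real mat \<Rightarrow> real mat \<Rightarrow> real vec set \<Rightarrow> real vec set \<Rightarrow> real" where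
  "kolmogorov_dist A B W U =
     (SUP z \<in> {z \<in> U. weighted_norm B z \<le> 1}. INF y \<in> W. weighted_norm A (z - y))"

definition lower_rows :: "nat \<Rightarrow> real mat \<Rightarrow> real mat" where
  "lower_rows k C = mat (dim_row C - k) (dim_col C) (\<lambda>(i, j). C $$ (k + i, j))"

end

theory Submission
  imports Defs "Jordan_Normal_Form.DL_Rank" "HOL-Analysis.L2_Norm"
begin

text \<open>
  In the eigenbasis the energy of the subspace spanned by the columns of \<open>Y = X C\<close> is the mean of
  the eigenvalues weighted by the squared row norms of \<open>C\<close>. These norms are at most 1 and sum to
  \<open>k\<close>, so the energy gap times \<open>k\<close> dominates \<open>\<lambda>\<^sub>k - \<lambda>\<^sub>k\<^sub>+\<^sub>1\<close> times the squared Frobenius norm of the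
  lower block, which in turn dominates \<open>s\<close>, the spectral norm of its Gram matrix; hence
  \<open>s \<le> 1/2\<close>. Then the upper block is invertible, and a vector \<open>z\<close> with leading coordinates \<open>a\<close>
  is approximated by the \<open>y = Y b\<close> with the same leading coordinates: the error only sees
  eigenvalues up to \<open>\<lambda>\<^sub>k\<^sub>+\<^sub>1\<close>, its squared coordinate norm is at most \<open>s |b|\<^sup>2\<close>, and
  \<open>(1 - s) |b|\<^sup>2 \<le> |a|\<^sup>2\<close>.
\<close>

section \<open>Scalar products, quadratic forms and traces under a change of basis\<close>

lemma scalar_prod_self_nonneg: "v \<bullet> v \<ge> 0" for v :: "real vec"
  by (auto simp: scalar_prod_def intro: sum_nonneg)

lemma scalar_prod_Cauchy_Schwarz:
  fixes u v :: "real vec"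
  assumes "u \<in> carrier_vec n" "v \<in> carrier_vec n"
  shows "(u \<bullet> v)\<^sup>2 \<le> (u \<bullet> u) * (v \<bullet> v)"
proof -
  have "\<bar>u \<bullet> v\<bar> \<le> (\<Sum>i<n. \<bar>u $ i\<bar> * \<bar>v $ i\<bar>)"
    using assms by (auto simp: scalar_prod_def atLeast0LessThan abs_mult[symmetric] intro: sum_abs)
  also have "\<dots> \<le> L2_set (($) u) {..<n} * L2_set (($) v) {..<n}"
    by (rule L2_set_mult_ineq)
  also have "\<dots> = sqrt ((u \<bullet> u) * (v \<bullet> v))"
    using assms
    by (simp add: L2_set_def scalar_prod_def atLeast0LessThan power2_eq_square real_sqrt_mult)
  finally have "\<bar>u \<bullet> v\<bar>\<^sup>2 \<le> (sqrt ((u \<bullet> u) * (v \<bullet> v)))\<^sup>2"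
    by (intro power_mono) auto
  then show ?thesis by (simp add: scalar_prod_self_nonneg)
qed

lemma scalar_prod_self_eq_sum: "v \<in> carrier_vec n \<Longrightarrow> v \<bullet> v = (\<Sum>i<n. (v $ i)\<^sup>2)"
  for v :: "real vec"
  by (auto simp: scalar_prod_def atLeast0LessThan power2_eq_square)

lemma mult_mat_vec_self:
  fixes L :: "real mat"
  assumes "L \<in> carrier_mat r m" "v \<in> carrier_vec m"
  shows "(L *\<^sub>v v) \<bullet> (L *\<^sub>v v) = v \<bullet> ((L\<^sup>T * L) *\<^sub>v v)"
proof -
  have "v \<bullet> (L\<^sup>T *\<^sub>v (L *\<^sub>v v)) = (L *\<^sub>v v) \<bullet> (L *\<^sub>v v)"
    using transpose_vec_mult_scalar[of "L\<^sup>T" m r "L *\<^sub>v v" v] assms by auto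
  then show ?thesis
    using assms by (simp add: assoc_mult_mat_vec[of _ m r _ m])
qed

lemma quadratic_form_mult_mat_vec:
  fixes X M :: "real mat"
  assumes "X \<in> carrier_mat n m" "M \<in> carrier_mat n n" "v \<in> carrier_vec m"
  shows "(X *\<^sub>v v) \<bullet> (M *\<^sub>v (X *\<^sub>v v)) = v \<bullet> ((X\<^sup>T * M * X) *\<^sub>v v)"
proof -
  have "v \<bullet> (X\<^sup>T *\<^sub>v (M *\<^sub>v (X *\<^sub>v v))) = (X *\<^sub>v v) \<bullet> (M *\<^sub>v (X *\<^sub>v v))"
    using transpose_vec_mult_scalar[of "X\<^sup>T" m n "M *\<^sub>v (X *\<^sub>v v)" v] assms by auto
  moreover have "(X\<^sup>T * M * X) *\<^sub>v v = X\<^sup>T *\<^sub>v (M *\<^sub>v (X *\<^sub>v v))"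
    using assms by (simp add: assoc_mult_mat_vec[of _ m n _ m] assoc_mult_mat_vec[of _ m n _ n])
  ultimately show ?thesis by simp
qed

lemma gram_index:
  fixes Z M :: "real mat"
  assumes "Z \<in> carrier_mat n m" "M \<in> carrier_mat n n" "i < m" "j < m"
  shows "(Z\<^sup>T * M * Z) $$ (i, j) = col Z i \<bullet> (M *\<^sub>v col Z j)"
proof -
  have "Z\<^sup>T * M * Z = Z\<^sup>T * (M * Z)"
    using assms by (intro assoc_mult_mat) auto
  moreover have "col (M * Z) j = M *\<^sub>v col Z j"
    using assms by (auto intro: eq_vecI)
  ultimately show ?thesis
    using assms by (simp add: index_mult_mat)
qed

text \<open>Moves a form evaluated on \<open>Y = X * C\<close> over to \<open>C\<close> alone. For
  the eigenvector matrix \<open>X\<close>, the inner factor \<open>X\<^sup>T * M * X\<close> is the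
  identity when \<open>M = B\<close> and the diagonal matrix of eigenvalues when
  \<open>M = A\<close>.\<close>

lemma gram_mult:
  fixes X M C :: "real mat"
  assumes "X \<in> carrier_mat n n" "M \<in> carrier_mat n n" "C \<in> carrier_mat n k"
  shows "(X * C)\<^sup>T * M * (X * C) = C\<^sup>T * (X\<^sup>T * M * X) * C"
proof -
  have "(X * C)\<^sup>T * M * (X * C) = C\<^sup>T * X\<^sup>T * M * X * C"
    using assms
    by (subst transpose_mult[of _ n n _ k]) (auto simp: assoc_mult_mat[of _ k n _ n _ k])
  also have "\<dots> = C\<^sup>T * (X\<^sup>T * M * X) * C"
    using assms by (simp add: assoc_mult_mat[of _ k n _ n _ n] assoc_mult_mat[of _ n n _ n _ n])
  finally show ?thesis .
qed

lemma mat_trace_comm: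
  assumes "P \<in> carrier_mat r c" "Q \<in> carrier_mat c r"
  shows "mat_trace (P * Q) = mat_trace (Q * P)"
proof -
  have "mat_trace (P * Q) = (\<Sum>i<r. \<Sum>j<c. P $$ (i, j) * Q $$ (j, i))"
    using assms by (auto simp: mat_trace_def scalar_prod_def atLeast0LessThan intro!: sum.cong)
  also have "\<dots> = (\<Sum>j<c. \<Sum>i<r. P $$ (i, j) * Q $$ (j, i))"
    by (rule sum.swap)
  also have "\<dots> = mat_trace (Q * P)"
    using assms by (auto simp: mat_trace_def scalar_prod_def atLeast0LessThan intro!: sum.cong)
  finally show ?thesis .
qed

section \<open>Frobenius and spectral norms, and rows of matrices with orthonormal columns\<close>

definition frobenius_sq :: "real mat \<Rightarrow> real" where
  "frobenius_sq L = (\<Sum>i<dim_row L. \<Sum>j<dim_col L. (L $$ (i, j))\<^sup>2)"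

lemma frobenius_sq_nonneg: "frobenius_sq L \<ge> 0"
  by (auto simp: frobenius_sq_def intro!: sum_nonneg)

lemma frobenius_sq_transpose: "frobenius_sq L\<^sup>T = frobenius_sq L"
  unfolding frobenius_sq_def by (subst sum.swap) auto

lemma mult_mat_vec_le_frobenius:
  assumes "L \<in> carrier_mat r m" "v \<in> carrier_vec m"
  shows "(L *\<^sub>v v) \<bullet> (L *\<^sub>v v) \<le> frobenius_sq L * (v \<bullet> v)"
proof -
  have "(L *\<^sub>v v) \<bullet> (L *\<^sub>v v) = (\<Sum>i<r. (row L i \<bullet> v)\<^sup>2)"
    using assms by (subst scalar_prod_self_eq_sum[of _ r]) auto
  also have "\<dots> \<le> (\<Sum>i<r. (row L i \<bullet> row L i) * (v \<bullet> v))"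
    using assms by (intro sum_mono scalar_prod_Cauchy_Schwarz[of _ m]) auto
  also have "\<dots> = frobenius_sq L * (v \<bullet> v)"
    using assms
    by (simp add: frobenius_sq_def sum_distrib_right[symmetric] scalar_prod_self_eq_sum[of "row L _" m])
  finally show ?thesis .
qed

lemma euclid_norm_nonneg: "euclid_norm v \<ge> 0"
  by (simp add: euclid_norm_def scalar_prod_self_nonneg)

text \<open>The Frobenius estimate is applied twice, to \<open>L\<close> and to its transpose, each
  time costing one factor \<open>frobenius_sq L\<close> in the squared norm. Besides bounding the
  spectral norm, this shows that the set in its supremum is bounded.\<close>

lemma euclid_norm_gram_le:
  assumes "L \<in> carrier_mat r m" "v \<in> carrier_vec m"
  shows "euclid_norm ((L\<^sup>T * L) *\<^sub>v v) \<le> frobenius_sq L * euclid_norm v"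
proof -
  let ?w = "(L\<^sup>T * L) *\<^sub>v v"
  have "?w = L\<^sup>T *\<^sub>v (L *\<^sub>v v)"
    using assms by (simp add: assoc_mult_mat_vec[of _ m r _ m])
  then have "?w \<bullet> ?w \<le> frobenius_sq L * ((L *\<^sub>v v) \<bullet> (L *\<^sub>v v))"
    using mult_mat_vec_le_frobenius[of "L\<^sup>T" m r "L *\<^sub>v v"] assms by (simp add: frobenius_sq_transpose)
  also have "\<dots> \<le> frobenius_sq L * (frobenius_sq L * (v \<bullet> v))"
    using assms by (intro mult_left_mono mult_mat_vec_le_frobenius frobenius_sq_nonneg)
  also have "\<dots> = (frobenius_sq L * euclid_norm v)\<^sup>2"
    by (simp add: euclid_norm_def power_mult_distrib scalar_prod_self_nonneg power2_eq_square)
  finally show ?thesis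
    unfolding euclid_norm_def[of ?w]
    by (intro real_le_lsqrt) (auto simp: frobenius_sq_nonneg euclid_norm_nonneg scalar_prod_self_nonneg)
qed

lemma spectral_norm_gram_le:
  assumes "L \<in> carrier_mat r m"
  shows "spectral_norm (L\<^sup>T * L) \<le> frobenius_sq L"
  unfolding spectral_norm_def
proof (rule cSUP_least)
  show "{v \<in> carrier_vec (dim_col (L\<^sup>T * L)). euclid_norm v \<le> 1} \<noteq> {}"
    using assms by (auto simp: euclid_norm_def intro!: exI[of _ "0\<^sub>v m"])
next
  fix v assume v: "v \<in> {v \<in> carrier_vec (dim_col (L\<^sup>T * L)). euclid_norm v \<le> 1}"
  then have "euclid_norm ((L\<^sup>T * L) *\<^sub>v v) \<le> frobenius_sq L * euclid_norm v"
    using assms by (intro euclid_norm_gram_le) auto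
  also have "\<dots> \<le> frobenius_sq L * 1"
    using v by (intro mult_left_mono frobenius_sq_nonneg) auto
  finally show "euclid_norm ((L\<^sup>T * L) *\<^sub>v v) \<le> frobenius_sq L" by simp
qed

text \<open>A real-valued \<open>SUP\<close> dominates its members only if they are bounded above;
  \<open>euclid_norm_gram_le\<close> supplies the bound.\<close>

lemma euclid_norm_le_spectral_norm_gram:
  assumes L: "L \<in> carrier_mat r m" and v: "v \<in> carrier_vec m" "euclid_norm v \<le> 1"
  shows "euclid_norm ((L\<^sup>T * L) *\<^sub>v v) \<le> spectral_norm (L\<^sup>T * L)"
  unfolding spectral_norm_def
proof (rule cSUP_upper)
  show "v \<in> {v \<in> carrier_vec (dim_col (L\<^sup>T * L)). euclid_norm v \<le> 1}"
    using assms by auto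
  show "bdd_above ((\<lambda>v. euclid_norm ((L\<^sup>T * L) *\<^sub>v v)) `
      {v \<in> carrier_vec (dim_col (L\<^sup>T * L)). euclid_norm v \<le> 1})"
  proof (intro bdd_aboveI2)
    fix w assume w: "w \<in> {v \<in> carrier_vec (dim_col (L\<^sup>T * L)). euclid_norm v \<le> 1}"
    then have "euclid_norm ((L\<^sup>T * L) *\<^sub>v w) \<le> frobenius_sq L * euclid_norm w"
      using L by (intro euclid_norm_gram_le) auto
    also have "\<dots> \<le> frobenius_sq L * 1"
      using w by (intro mult_left_mono frobenius_sq_nonneg) auto
    finally show "euclid_norm ((L\<^sup>T * L) *\<^sub>v w) \<le> frobenius_sq L" by simp
  qed
qed

lemma spectral_norm_gram_nonneg:
  assumes "L \<in> carrier_mat r m"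
  shows "spectral_norm (L\<^sup>T * L) \<ge> 0"
  by (rule order_trans[OF euclid_norm_nonneg euclid_norm_le_spectral_norm_gram[OF assms, of "0\<^sub>v m"]])
    (auto simp: euclid_norm_def)

text \<open>For a unit vector \<open>u\<close>, the value
  \<open>(L *\<^sub>v u) \<bullet> (L *\<^sub>v u)\<close> equals
  \<open>u \<bullet> ((L\<^sup>T * L) *\<^sub>v u)\<close>, which Cauchy-Schwarz bounds by the
  length of \<open>(L\<^sup>T * L) *\<^sub>v u\<close>. The general case follows by scaling.\<close>

lemma mult_mat_vec_le_spectral_norm_gram:
  assumes L: "L \<in> carrier_mat r m" and v: "v \<in> carrier_vec m"
  shows "(L *\<^sub>v v) \<bullet> (L *\<^sub>v v) \<le> spectral_norm (L\<^sup>T * L) * (v \<bullet> v)"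
proof (cases "v \<bullet> v = 0")
  case True
  \<comment> \<open>Normalising is impossible here, but the right-hand side is 0 and the Frobenius
    bound makes the left-hand side at most 0.\<close>
  then show ?thesis using mult_mat_vec_le_frobenius[OF L v] by simp
next
  case False
  define t where "t = euclid_norm v"
  have t: "t > 0" "t\<^sup>2 = v \<bullet> v"
    using False scalar_prod_self_nonneg[of v] by (auto simp: t_def euclid_norm_def)
  define u where "u = (1 / t) \<cdot>\<^sub>v v"
  have u: "u \<in> carrier_vec m" using v by (simp add: u_def)
  have vu: "v = t \<cdot>\<^sub>v u" using t v by (auto simp: u_def intro!: eq_vecI)
  have "u \<bullet> u = (v \<bullet> v) / t\<^sup>2"
    using v by (simp add: u_def power2_eq_square)
  then have uu: "u \<bullet> u = 1" using False by (simp add: t(2))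
  have Su: "(L\<^sup>T * L) *\<^sub>v u \<in> carrier_vec m" using L u by auto
  have "((L *\<^sub>v u) \<bullet> (L *\<^sub>v u))\<^sup>2 \<le> (u \<bullet> u) * (((L\<^sup>T * L) *\<^sub>v u) \<bullet> ((L\<^sup>T * L) *\<^sub>v u))"
    unfolding mult_mat_vec_self[OF L u] by (rule scalar_prod_Cauchy_Schwarz[OF u Su])
  also have "\<dots> = (euclid_norm ((L\<^sup>T * L) *\<^sub>v u))\<^sup>2"
    by (simp add: uu euclid_norm_def scalar_prod_self_nonneg)
  also have "\<dots> \<le> (spectral_norm (L\<^sup>T * L))\<^sup>2"
    using uu by (intro power_mono euclid_norm_le_spectral_norm_gram[OF L u] euclid_norm_nonneg)
      (simp add: euclid_norm_def)
  finally have "(L *\<^sub>v u) \<bullet> (L *\<^sub>v u) \<le> spectral_norm (L\<^sup>T * L)"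
    using spectral_norm_gram_nonneg[OF L] by (rule power2_le_imp_le)
  then have "t\<^sup>2 * ((L *\<^sub>v u) \<bullet> (L *\<^sub>v u)) \<le> t\<^sup>2 * spectral_norm (L\<^sup>T * L)"
    by (intro mult_left_mono) auto
  moreover have "L *\<^sub>v v = t \<cdot>\<^sub>v (L *\<^sub>v u)"
    using L u by (simp add: vu mult_mat_vec)
  then have "(L *\<^sub>v v) \<bullet> (L *\<^sub>v v) = t\<^sup>2 * ((L *\<^sub>v u) \<bullet> (L *\<^sub>v u))"
    using L u by (simp add: power2_eq_square)
  ultimately show ?thesis by (simp add: t(2) mult.commute)
qed

text \<open>Let \<open>r\<close> be the row. Entry \<open>i\<close> of \<open>C *\<^sub>v r\<close>
  is \<open>r \<bullet> r\<close>, and \<open>C\<close> preserves lengths, so the square of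
  \<open>r \<bullet> r\<close> is at most \<open>r \<bullet> r\<close>.\<close>

lemma row_of_orthonormal_cols_le_1:
  fixes C :: "real mat"
  assumes C: "C \<in> carrier_mat n k" "C\<^sup>T * C = 1\<^sub>m k" and i: "i < n"
  shows "row C i \<bullet> row C i \<le> 1"
proof -
  let ?r = "row C i"
  have r: "?r \<in> carrier_vec k" using C i by auto
  have "(?r \<bullet> ?r)\<^sup>2 = ((C *\<^sub>v ?r) $ i)\<^sup>2" using C i by simp
  also have "\<dots> \<le> (\<Sum>l<n. ((C *\<^sub>v ?r) $ l)\<^sup>2)"
    using i by (intro member_le_sum) auto
  also have "\<dots> = (C *\<^sub>v ?r) \<bullet> (C *\<^sub>v ?r)"
    using C r by (intro scalar_prod_self_eq_sum[symmetric]) auto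
  also have "\<dots> = ?r \<bullet> ?r"
    using mult_mat_vec_self[OF C(1) r] C r by simp
  finally have le: "(?r \<bullet> ?r) * (?r \<bullet> ?r) \<le> ?r \<bullet> ?r" by (simp add: power2_eq_square)
  show ?thesis
  proof (rule ccontr)
    assume "\<not> ?thesis"
    then have "(?r \<bullet> ?r) * 1 < (?r \<bullet> ?r) * (?r \<bullet> ?r)" by (intro mult_strict_left_mono) auto
    with le show False by simp
  qed
qed

section \<open>Diagonal quadratic forms and their traces\<close>

definition diag_of :: "nat \<Rightarrow> (nat \<Rightarrow> real) \<Rightarrow> real mat" where
  "diag_of n d = mat n n (\<lambda>(i, j). if i = j then d i else 0)"

lemma diag_of_carrier[simp]: "diag_of n d \<in> carrier_mat n n"
  by (simp add: diag_of_def)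

lemma diag_of_mult_vec_index:
  assumes "v \<in> carrier_vec n" "i < n"
  shows "(diag_of n d *\<^sub>v v) $ i = d i * v $ i"
  using assms
  by (auto simp: diag_of_def scalar_prod_def if_distrib[of "\<lambda>x. x * _"] cong: if_cong)

lemma diag_of_quadratic_form:
  assumes "v \<in> carrier_vec n"
  shows "v \<bullet> (diag_of n d *\<^sub>v v) = (\<Sum>i<n. d i * (v $ i)\<^sup>2)"
proof -
  have "v \<bullet> (diag_of n d *\<^sub>v v) = (\<Sum>i<n. v $ i * (diag_of n d *\<^sub>v v) $ i)"
    by (auto simp: scalar_prod_def diag_of_def atLeast0LessThan)
  then show ?thesis
    using assms by (simp add: diag_of_mult_vec_index power2_eq_square mult_ac)
qed

text \<open>The trace runs over columns of \<open>C\<close>; exchanging the sums turns it into a sum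
  over eigenvalues whose weights are squared row norms. With all \<open>d i = 1\<close> it also
  yields the total of these weights.\<close>

lemma mat_trace_diag_of:
  assumes "C \<in> carrier_mat n k"
  shows "mat_trace (C\<^sup>T * diag_of n d * C) = (\<Sum>i<n. d i * (row C i \<bullet> row C i))"
proof -
  have "mat_trace (C\<^sup>T * diag_of n d * C) = (\<Sum>j<k. col C j \<bullet> (diag_of n d *\<^sub>v col C j))"
    using assms by (simp add: mat_trace_def gram_index[of _ n k] del: index_mult_mat(1))
  also have "\<dots> = (\<Sum>j<k. \<Sum>i<n. d i * (C $$ (i, j))\<^sup>2)"
    using assms by (intro sum.cong) (auto simp: diag_of_quadratic_form)
  also have "\<dots> = (\<Sum>i<n. \<Sum>j<k. d i * (C $$ (i, j))\<^sup>2)"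
    by (rule sum.swap)
  also have "\<dots> = (\<Sum>i<n. d i * (row C i \<bullet> row C i))"
    using assms by (intro sum.cong) (auto simp: scalar_prod_self_eq_sum[of _ k] sum_distrib_left)
  finally show ?thesis .
qed

section \<open>Basis matrices of a subspace, the energy and the energy gap\<close>

lemma orthonormal_basis_mat_range:
  assumes W: "is_subspace n W" and Z: "orthonormal_basis_mat n B W Z"
  shows "W = {Z *\<^sub>v v | v. v \<in> carrier_vec (dim_col Z)}"
proof -
  interpret vec_space "TYPE(real)" n .
  have Zc: "Z \<in> carrier_mat n (dim_col Z)"
    using Z by (auto simp: orthonormal_basis_mat_def)
  have sub: "VectorSpace.subspace class_ring W V" "submodule class_ring W V"
    using W by (auto simp: is_subspace_def VectorSpace.subspace_def)
  interpret W: vectorspace class_ring "V\<lparr>carrier := W\<rparr>"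
    by (rule subspace_is_vs[OF sub(1)])
  have b: "W.basis (set (cols Z))"
    using Z by (simp add: orthonormal_basis_mat_def)
  then have "set (cols Z) \<subseteq> W" "W.span (set (cols Z)) = W"
    by (auto simp: W.basis_def)
  \<comment> \<open>\<open>W.span\<close> is formed inside the module with carrier \<open>W\<close>;
    for subsets of a submodule it agrees with the span in the whole space.\<close>
  then have "W = span (set (cols Z))"
    using span_li_not_depend(1)[OF _ sub(2)] by simp
  also have "\<dots> = {Z *\<^sub>v v | v. v \<in> carrier_vec (dim_col Z)}"
    unfolding col_space_eq[OF Zc, unfolded col_space_def]
    using mult_mat_vec_carrier[OF Zc] carrier_matD(1)[OF Zc] by blast
  finally show ?thesis .
qed

lemma orthonormal_basis_mat_gram:
  assumes B: "B \<in> carrier_mat n n" and Z: "orthonormal_basis_mat n B W Z"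
  shows "Z\<^sup>T * B * Z = 1\<^sub>m (dim_col Z)"
proof (rule eq_matI)
  fix i j assume "i < dim_row (1\<^sub>m (dim_col Z) :: real mat)" "j < dim_col (1\<^sub>m (dim_col Z) :: real mat)"
  then have ij: "i < dim_col Z" "j < dim_col Z" by auto
  have Zc: "Z \<in> carrier_mat n (dim_col Z)" using Z by (auto simp: orthonormal_basis_mat_def)
  show "(Z\<^sup>T * B * Z) $$ (i, j) = 1\<^sub>m (dim_col Z) $$ (i, j)"
    unfolding gram_index[OF Zc B ij] using Z ij by (auto simp: orthonormal_basis_mat_def)
qed auto

text \<open>\<open>Z Z\<^sup>T B\<close> is the \<open>B\<close>-orthogonal projector onto the subspace.\<close>

lemma orthonormal_basis_mat_projector:
  assumes B: "B \<in> carrier_mat n n" and W: "is_subspace n W"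
    and Z: "orthonormal_basis_mat n B W Z" and Y: "orthonormal_basis_mat n B W Y"
  shows "Z * (Z\<^sup>T * B * Y) = Y"
proof -
  define m where "m = dim_col Z"
  define k where "k = dim_col Y"
  have Zc: "Z \<in> carrier_mat n m" using Z by (auto simp: orthonormal_basis_mat_def m_def)
  have Yc: "Y \<in> carrier_mat n k" using Y by (auto simp: orthonormal_basis_mat_def k_def)
  have "\<exists>v \<in> carrier_vec m. col Y j = Z *\<^sub>v v" if "j < k" for j
  proof -
    have "col Y j = Y *\<^sub>v unit_vec k j"
      using that Yc by (auto intro!: eq_vecI)
    then have "col Y j \<in> W"
      using orthonormal_basis_mat_range[OF W Y] that by (auto simp: k_def)
    then show ?thesis
      using orthonormal_basis_mat_range[OF W Z] by (auto simp: m_def)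
  qed
  then obtain q where q: "\<And>j. j < k \<Longrightarrow> q j \<in> carrier_vec m" "\<And>j. j < k \<Longrightarrow> col Y j = Z *\<^sub>v q j"
    by metis
  \<comment> \<open>\<open>Q\<close> collects the coordinates of the columns of \<open>Y\<close>
    with respect to \<open>Z\<close>. Once \<open>Y = Z * Q\<close> is known, multiplying by
    \<open>Z\<^sup>T * B\<close> identifies \<open>Q\<close> with
    \<open>Z\<^sup>T * B * Y\<close>.\<close>
  define Q where "Q = mat_of_cols m (map q [0..<k])"
  have Qc: "Q \<in> carrier_mat m k" unfolding Q_def
    by (metis diff_zero length_map length_upt mat_of_cols_carrier(1))
  have YQ: "Y = Z * Q"
  proof (rule eq_matI)
    fix i j assume "i < dim_row (Z * Q)" "j < dim_col (Z * Q)"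
    then have ij: "i < n" "j < k" using Zc Qc by auto
    have "Y $$ (i, j) = col Y j $ i" using ij Yc by simp
    also have "\<dots> = row Z i \<bullet> col Q j" using ij q Zc by (simp add: Q_def col_mat_of_cols)
    finally show "Y $$ (i, j) = (Z * Q) $$ (i, j)" using ij Zc Qc by simp
  qed (use Yc Zc Qc in auto)
  have "Z\<^sup>T * B * Y = (Z\<^sup>T * B * Z) * Q"
    using Zc B Qc by (simp add: YQ assoc_mult_mat[of _ m n _ n _ k] assoc_mult_mat[of _ m n _ n _ m]
        assoc_mult_mat[of _ m n _ m _ k] assoc_mult_mat[of _ n n _ m _ k])
  then show ?thesis
    using orthonormal_basis_mat_gram[OF B Z] Qc YQ by (simp add: m_def left_mult_one_mat[OF Qc[unfolded m_def]])
qed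

text \<open>For \<open>Q = Z\<^sup>T * B * Y\<close>, the projector property gives
  \<open>Z * Q = Y\<close> and \<open>Y * Q\<^sup>T = Z\<close>. Hence
  \<open>Y\<^sup>T * M * Y = (Y\<^sup>T * M * Z) * Q\<close>, and moving \<open>Q\<close> to the
  front under the trace turns \<open>Q * Y\<^sup>T\<close> into \<open>Z\<^sup>T\<close>.\<close>

lemma orthonormal_basis_mat_trace:
  assumes B: "B \<in> carrier_mat n n" "B\<^sup>T = B" and M: "M \<in> carrier_mat n n"
    and W: "is_subspace n W"
    and Z: "orthonormal_basis_mat n B W Z" and Y: "orthonormal_basis_mat n B W Y"
  shows "mat_trace (Z\<^sup>T * M * Z) = mat_trace (Y\<^sup>T * M * Y)"
proof -
  define m where "m = dim_col Z"
  define k where "k = dim_col Y"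
  have Zc[simp]: "Z \<in> carrier_mat n m" using Z by (auto simp: orthonormal_basis_mat_def m_def)
  have Yc[simp]: "Y \<in> carrier_mat n k" using Y by (auto simp: orthonormal_basis_mat_def k_def)
  note [simp] = B(1) M
  define Q where "Q = Z\<^sup>T * B * Y"
  have Qc[simp]: "Q \<in> carrier_mat m k" "Q\<^sup>T \<in> carrier_mat k m" unfolding Q_def by (auto intro!: mult_carrier_mat[of _ m n])
  have ZQ: "Z * Q = Y"
    unfolding Q_def by (rule orthonormal_basis_mat_projector[OF B(1) W Z Y])
  have QT: "Y\<^sup>T * B * Z = Q\<^sup>T"
  proof -
    have "Z\<^sup>T * B \<in> carrier_mat m n" by (intro mult_carrier_mat[of _ m n]) auto
    then have "Q\<^sup>T = Y\<^sup>T * (B\<^sup>T * Z)"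
      unfolding Q_def by (simp add: transpose_mult[of _ m n _ k] transpose_mult[of _ m n _ n])
    then show ?thesis by (simp add: B(2) assoc_mult_mat[of _ k n _ n _ m])
  qed
  have YQ: "Y * Q\<^sup>T = Z"
    using orthonormal_basis_mat_projector[OF B(1) W Y Z] QT by simp
  have "Y\<^sup>T * M \<in> carrier_mat k n" by (intro mult_carrier_mat[of _ k n]) auto
  then have "mat_trace (Y\<^sup>T * M * Y) = mat_trace ((Y\<^sup>T * M * Z) * Q)"
    by (subst (2) ZQ[symmetric]) (simp add: assoc_mult_mat[of _ k n _ m _ k])
  also have "\<dots> = mat_trace (Q * (Y\<^sup>T * M * Z))"
    using \<open>Y\<^sup>T * M \<in> carrier_mat k n\<close>
    by (intro mat_trace_comm[of _ k m] mult_carrier_mat[of _ k n _ m]) auto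
  also have "Q * (Y\<^sup>T * M * Z) = (Y * Q\<^sup>T)\<^sup>T * M * Z"
    using \<open>Y\<^sup>T * M \<in> carrier_mat k n\<close>
    by (simp add: transpose_mult[of _ n k _ m] assoc_mult_mat[of _ m k _ n _ m]
        assoc_mult_mat[of _ m k _ n _ n])
  finally show ?thesis unfolding YQ by simp
qed

text \<open>The given \<open>Z\<close> shows that the choice by \<open>SOME\<close> yields a genuine
  basis matrix, and basis independence of both traces replaces it by \<open>Z\<close>. The
  denominator is then the trace of an identity matrix.\<close>

lemma energy_eq:
  assumes B: "B \<in> carrier_mat n n" "B\<^sup>T = B" and A: "A \<in> carrier_mat n n"
    and W: "is_subspace n W" and Z: "orthonormal_basis_mat n B W Z"
  shows "energy n A B W = mat_trace (Z\<^sup>T * A * Z) / real (dim_col Z)"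
proof -
  define Z' where "Z' = (SOME Z. orthonormal_basis_mat n B W Z)"
  have Z': "orthonormal_basis_mat n B W Z'"
    unfolding Z'_def using Z by (rule someI)
  have "mat_trace (Z\<^sup>T * B * Z) = real (dim_col Z)"
    unfolding orthonormal_basis_mat_gram[OF B(1) Z] by (simp add: mat_trace_def)
  then show ?thesis
    unfolding energy_def Z'_def[symmetric] Let_def
    using orthonormal_basis_mat_trace[OF B A W Z' Z] orthonormal_basis_mat_trace[OF B B(1) W Z' Z]
    by simp
qed

text \<open>The Gram identity alone provides independence: \<open>Z *\<^sub>v v = 0\<close> forces
  \<open>v = (Z\<^sup>T * B * Z) *\<^sub>v v = 0\<close>. This makes the leading eigenvectors a
  basis matrix of their span.\<close>

lemma orthonormal_basis_mat_span:
  assumes B: "B \<in> carrier_mat n n" and Z: "Z \<in> carrier_mat n m" and gram: "Z\<^sup>T * B * Z = 1\<^sub>m m"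
  shows "orthonormal_basis_mat n B (span_vecs n (set (cols Z))) Z"
    and "is_subspace n (span_vecs n (set (cols Z)))"
proof -
  interpret vec_space "TYPE(real)" n .
  let ?W = "span (set (cols Z))"
  have cols: "set (cols Z) \<subseteq> carrier_vec n" using Z cols_dim by blast
  have sub: "VectorSpace.subspace class_ring ?W V" "submodule class_ring ?W V"
    using span_is_subspace[of "set (cols Z)"] cols by (auto simp: VectorSpace.subspace_def)
  then show "is_subspace n (span_vecs n (set (cols Z)))"
    by (simp add: is_subspace_def span_vecs_def)
  interpret W: vectorspace class_ring "V\<lparr>carrier := ?W\<rparr>"
    by (rule subspace_is_vs[OF sub(1)])
  have orth: "col Z i \<bullet> (B *\<^sub>v col Z j) = (if i = j then 1 else 0)" if "i < m" "j < m" for i j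
    using gram_index[OF Z B that] that by (simp add: gram)
  \<comment> \<open>\<open>lin_indpt\<close> speaks of the set of columns, so repeated columns must
    be excluded before the kernel of \<open>Z\<close> can decide independence.\<close>
  have "distinct (cols Z)"
    unfolding distinct_conv_nth
  proof (intro allI impI)
    fix i j assume "i < length (cols Z)" "j < length (cols Z)" "i \<noteq> j"
    then have "i < m" "j < m" "i \<noteq> j" using Z by auto
    then show "cols Z ! i \<noteq> cols Z ! j"
      using orth[of i j] orth[of j j] Z by auto
  qed
  moreover have "v = 0\<^sub>v m" if v: "v \<in> carrier_vec m" and Zv: "Z *\<^sub>v v = 0\<^sub>v n" for v
  proof -
    have zero: "P *\<^sub>v 0\<^sub>v n = 0\<^sub>v m" if "P \<in> carrier_mat m n" for P :: "real mat"
      using that by auto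
    have "v = (Z\<^sup>T * B * Z) *\<^sub>v v" using v by (simp add: gram)
    also have "\<dots> = (Z\<^sup>T * B) *\<^sub>v (Z *\<^sub>v v)"
      using v Z B by (intro assoc_mult_mat_vec[of _ m n _ m]) auto
    also have "\<dots> = 0\<^sub>v m" unfolding Zv using Z B by (intro zero) auto
    finally show ?thesis .
  qed
  ultimately have "lin_indpt (set (cols Z))"
    using lin_depE[OF Z] by metis
  then have "W.basis (set (cols Z))"
    unfolding W.basis_def
    using span_li_not_depend[OF _ sub(2), of "set (cols Z)"] in_own_span[of "set (cols Z)"] cols
    by auto
  then show "orthonormal_basis_mat n B (span_vecs n (set (cols Z))) Z"
    using orth Z by (simp add: orthonormal_basis_mat_def span_vecs_def)
qed

text \<open>Since the weights sum to \<open>k\<close>, the weight missing on the first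
  \<open>k\<close> indices equals the weight present on the others. Each unit so moved goes from a
  value at least \<open>p\<close> to a value at most \<open>q\<close>, which costs at least
  \<open>p - q\<close>.\<close>

lemma sum_diff_weighted_ge:
  fixes d c :: "nat \<Rightarrow> real"
  assumes "k \<le> n" and p: "\<And>i. i < k \<Longrightarrow> p \<le> d i" and q: "\<And>i. k \<le> i \<Longrightarrow> i < n \<Longrightarrow> d i \<le> q"
    and c: "\<And>i. i < n \<Longrightarrow> 0 \<le> c i" "\<And>i. i < n \<Longrightarrow> c i \<le> 1"
    and sum: "(\<Sum>i<n. c i) = real k"
  shows "(p - q) * (\<Sum>i=k..<n. c i) \<le> (\<Sum>i<k. d i) - (\<Sum>i<n. d i * c i)"
proof -
  have split: "(\<Sum>i<n. g i) = (\<Sum>i<k. g i) + (\<Sum>i=k..<n. g i)" for g :: "nat \<Rightarrow> real"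
    using \<open>k \<le> n\<close> sum.atLeastLessThan_concat[of 0 k n g] by (simp add: atLeast0LessThan)
  have "(\<Sum>i<k. 1 - c i) = (\<Sum>i=k..<n. c i)"
    using sum split[of c] by (simp add: sum_subtractf)
  moreover have "p * (\<Sum>i<k. 1 - c i) \<le> (\<Sum>i<k. d i * (1 - c i))"
    unfolding sum_distrib_left using \<open>k \<le> n\<close> by (intro sum_mono mult_right_mono p) (auto simp: c)
  then have "p * (\<Sum>i<k. 1 - c i) \<le> (\<Sum>i<k. d i) - (\<Sum>i<k. d i * c i)"
    by (simp only: right_diff_distrib sum_subtractf mult_1_right)
  ultimately have "p * (\<Sum>i=k..<n. c i) \<le> (\<Sum>i<k. d i) - (\<Sum>i<k. d i * c i)"
    by simp
  moreover have "(\<Sum>i=k..<n. d i * c i) \<le> q * (\<Sum>i=k..<n. c i)"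
    unfolding sum_distrib_left by (intro sum_mono mult_right_mono q) (auto simp: c)
  ultimately show ?thesis
    using split[of "\<lambda>i. d i * c i"] by (simp add: left_diff_distrib)
qed

section \<open>Lower and upper blocks of the coefficient matrix\<close>

lemma lower_rows_carrier: "C \<in> carrier_mat n k \<Longrightarrow> lower_rows m C \<in> carrier_mat (n - m) k"
  by (auto simp: lower_rows_def)

lemma frobenius_sq_lower_rows:
  assumes "C \<in> carrier_mat n k" "m \<le> n"
  shows "frobenius_sq (lower_rows m C) = (\<Sum>i=m..<n. row C i \<bullet> row C i)"
proof -
  have "row C i \<bullet> row C i = (\<Sum>j<k. (C $$ (i, j))\<^sup>2)" if "i < n" for i
    using assms that by (subst scalar_prod_self_eq_sum[of _ k]) auto
  then show ?thesis
    using assms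
    by (auto simp: frobenius_sq_def lower_rows_def
        intro!: sum.reindex_bij_witness[of _ "\<lambda>i. i - m" "\<lambda>i. m + i"])
qed

lemma lower_rows_mult_vec_self:
  assumes "C \<in> carrier_mat n k" "m \<le> n" "v \<in> carrier_vec k"
  shows "(lower_rows m C *\<^sub>v v) \<bullet> (lower_rows m C *\<^sub>v v) = (\<Sum>i=m..<n. ((C *\<^sub>v v) $ i)\<^sup>2)"
proof -
  have "(lower_rows m C *\<^sub>v v) \<bullet> (lower_rows m C *\<^sub>v v) = (\<Sum>i<n - m. ((C *\<^sub>v v) $ (m + i))\<^sup>2)"
    using assms
    by (subst scalar_prod_self_eq_sum[of _ "n - m"]) (auto simp: lower_rows_def scalar_prod_def intro!: mult_mat_vec_carrier[of _ _ k])
  also have "\<dots> = (\<Sum>i=m..<n. ((C *\<^sub>v v) $ i)\<^sup>2)"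
    using assms by (auto intro!: sum.reindex_bij_witness[of _ "\<lambda>i. i - m" "\<lambda>i. m + i"])
  finally show ?thesis .
qed

text \<open>The upper block of \<open>C\<close> shrinks squared norms at most by the factor \<open>1 - s\<close>, hence it is invertible.\<close>

lemma orthonormal_cols_solve_upper_block:
  fixes C :: "real mat"
  defines "s \<equiv> \<lambda>k. spectral_norm ((lower_rows k C)\<^sup>T * lower_rows k C)"
  assumes C: "C \<in> carrier_mat n k" "C\<^sup>T * C = 1\<^sub>m k" "k \<le> n" and s: "s k < 1"
    and a: "a \<in> carrier_vec k"
  obtains b where "b \<in> carrier_vec k" "\<And>i. i < k \<Longrightarrow> (C *\<^sub>v b) $ i = a $ i"
    "(1 - s k) * (b \<bullet> b) \<le> a \<bullet> a" "(\<Sum>i=k..<n. ((C *\<^sub>v b) $ i)\<^sup>2) \<le> s k * (b \<bullet> b)"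
proof -
  define U where "U = mat k k (\<lambda>(i, j). C $$ (i, j))"
  have U: "U \<in> carrier_mat k k" by (simp add: U_def)
  have Uv: "(U *\<^sub>v v) $ i = (C *\<^sub>v v) $ i" if "v \<in> carrier_vec k" "i < k" for v i
    using that C by (auto simp: U_def scalar_prod_def)
  have low: "(\<Sum>i=k..<n. ((C *\<^sub>v v) $ i)\<^sup>2) \<le> s k * (v \<bullet> v)" if "v \<in> carrier_vec k" for v
    using mult_mat_vec_le_spectral_norm_gram[OF lower_rows_carrier[OF C(1)] that, of k]
      lower_rows_mult_vec_self[OF C(1,3) that] by (simp add: s_def)
  have up: "(1 - s k) * (v \<bullet> v) \<le> (U *\<^sub>v v) \<bullet> (U *\<^sub>v v)" if v: "v \<in> carrier_vec k" for v
  proof -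
    \<comment> \<open>\<open>C\<close> preserves lengths, so the squared norm of \<open>v\<close>
      splits into the upper rows, which form \<open>U *\<^sub>v v\<close>, and the lower rows, which
      \<open>low\<close> controls.\<close>
    have "v \<bullet> v = (\<Sum>i<n. ((C *\<^sub>v v) $ i)\<^sup>2)"
      using mult_mat_vec_self[OF C(1) v] C v scalar_prod_self_eq_sum[of "C *\<^sub>v v" n] by simp
    also have "\<dots> = (\<Sum>i<k. ((C *\<^sub>v v) $ i)\<^sup>2) + (\<Sum>i=k..<n. ((C *\<^sub>v v) $ i)\<^sup>2)"
      using C(3) sum.atLeastLessThan_concat[of 0 k n "\<lambda>i. ((C *\<^sub>v v) $ i)\<^sup>2"]
      by (simp add: atLeast0LessThan)
    also have "(\<Sum>i<k. ((C *\<^sub>v v) $ i)\<^sup>2) = (U *\<^sub>v v) \<bullet> (U *\<^sub>v v)"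
      using U v by (subst scalar_prod_self_eq_sum[of _ k]) (auto simp: Uv simp del: index_mult_mat_vec)
    finally show ?thesis using low[OF v] by (simp add: left_diff_distrib)
  qed
  have "det U \<noteq> 0"
  proof
    assume "det U = 0"
    then obtain v where v: "v \<in> carrier_vec k" "v \<noteq> 0\<^sub>v k" "U *\<^sub>v v = 0\<^sub>v k"
      using det_0_iff_vec_prod_zero[OF U] by auto
    then have "(1 - s k) * (v \<bullet> v) \<le> 0" using up[of v] by simp
    then have "v \<bullet> v \<le> 0" using s by (simp add: mult_le_0_iff)
    then have "v \<bullet> v = 0" using scalar_prod_self_nonneg[of v] by simp
    then have "(\<Sum>i<k. (v $ i)\<^sup>2) = 0" using v by (simp add: scalar_prod_self_eq_sum)
    then have "v = 0\<^sub>v k" using v by (subst (asm) sum_nonneg_eq_0_iff) (auto intro!: eq_vecI)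
    with v show False by simp
  qed
  \<comment> \<open>The parameter \<open>b\<close> of \<open>ring_mat\<close> only fills the record
    extension, so an arbitrary value serves.\<close>
  then obtain V where V: "V \<in> carrier_mat k k" "U * V = 1\<^sub>m k"
    using det_non_zero_imp_unit[OF U, where b = undefined] by (auto simp: Units_def ring_mat_def)
  define b where "b = V *\<^sub>v a"
  have b: "b \<in> carrier_vec k" using V a by (simp add: b_def)
  have Ub: "U *\<^sub>v b = a"
    using V a U by (simp add: b_def assoc_mult_mat_vec[symmetric, of _ k k _ k])
  show thesis
    using that[of b] b Uv[OF b] Ub up[OF b] low[OF b] by simp
qed

section \<open>Upper bounds for the Kolmogorov distance\<close>

lemma spd_quadratic_form_nonneg: "spd n M \<Longrightarrow> v \<in> carrier_vec n \<Longrightarrow> v \<bullet> (M *\<^sub>v v) \<ge> 0"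
  by (cases "v = 0\<^sub>v n") (auto simp: spd_def intro: less_imp_le)

text \<open>One good approximant per \<open>z\<close> suffices. The real-valued operators add two
  side conditions: the infimum is bounded below because the form of \<open>A\<close> is nonnegative,
  and the supremum is over a nonempty set because of the zero vector.\<close>

lemma kolmogorov_dist_le:
  assumes A: "spd n A" and W: "W \<subseteq> carrier_vec n" and U: "U \<subseteq> carrier_vec n" "0\<^sub>v n \<in> U"
    and B: "B \<in> carrier_mat n n"
    and approx: "\<And>z. z \<in> U \<Longrightarrow> weighted_norm B z \<le> 1 \<Longrightarrow> \<exists>y\<in>W. weighted_norm A (z - y) \<le> r"
  shows "kolmogorov_dist A B W U \<le> r"
  unfolding kolmogorov_dist_def
proof (rule cSUP_least)
  have "0\<^sub>v n \<bullet> (B *\<^sub>v 0\<^sub>v n) = (0::real)" using B by simp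
  then show "{z \<in> U. weighted_norm B z \<le> 1} \<noteq> {}"
    using U by (auto simp: weighted_norm_def intro!: exI[of _ "0\<^sub>v n"])
next
  fix z assume z: "z \<in> {z \<in> U. weighted_norm B z \<le> 1}"
  then obtain y where y: "y \<in> W" "weighted_norm A (z - y) \<le> r" using approx by auto
  have "bdd_below ((\<lambda>y. weighted_norm A (z - y)) ` W)"
    using W U z A by (intro bdd_belowI2[of _ 0]) (auto simp: weighted_norm_def intro!: spd_quadratic_form_nonneg minus_carrier_vec)
  then show "(INF y\<in>W. weighted_norm A (z - y)) \<le> r"
    using y by (rule cINF_lower2)
qed

section \<open>Both distance bounds, in eigenbasis coordinates\<close>

theorem theorem4p1:
  fixes n k :: nat
    and A B Y C :: "real mat"
    and lam :: "nat \<Rightarrow> real"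
    and x :: "nat \<Rightarrow> real vec"
    and Xh \<Y> :: "real vec set"
  assumes Xh: "Xh = span_vecs n (x ` {1..k})"
    and A: "spd n A" and B: "spd n B"
    and k: "1 \<le> k" "k < n"
    and x_carrier: "\<And>i. i \<in> {1..n} \<Longrightarrow> x i \<in> carrier_vec n"
    and eigen: "\<And>i. i \<in> {1..n} \<Longrightarrow> A *\<^sub>v x i = lam i \<cdot>\<^sub>v (B *\<^sub>v x i)"
    and x_B: "\<And>i j. i \<in> {1..n} \<Longrightarrow> j \<in> {1..n} \<Longrightarrow>
                x i \<bullet> (B *\<^sub>v x j) = (if i = j then 1 else 0)"
    and x_A: "\<And>i j. i \<in> {1..n} \<Longrightarrow> j \<in> {1..n} \<Longrightarrow>
                x i \<bullet> (A *\<^sub>v x j) = (if i = j then lam i else 0)"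
    and ordered: "\<And>i. 1 \<le> i \<Longrightarrow> i < n \<Longrightarrow> lam (i + 1) \<le> lam i"
    and gap: "lam (k + 1) < lam k"
    and pos: "lam n > 0"
    and \<Y>: "is_subspace n \<Y>" "subspace_dim n \<Y> = k"
    and Y: "Y \<in> carrier_mat n k" "orthonormal_basis_mat n B \<Y> Y"
    and C: "C \<in> carrier_mat n k" "Y = mat_of_cols n (map x [1..<n + 1]) * C"
    and small: "energy n A B Xh - energy n A B \<Y> \<le> (lam k - lam (k + 1)) / (2 * real k)"
  shows "kolmogorov_dist A B \<Y> Xh
           \<le> sqrt (lam (k + 1) *
               (spectral_norm ((lower_rows k C)\<^sup>T * lower_rows k C)
                / (1 - spectral_norm ((lower_rows k C)\<^sup>T * lower_rows k C))))
       \<and> kolmogorov_dist A B \<Y> Xh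
           \<le> sqrt (2 * lam (k + 1) *
               (real k * (energy n A B Xh - energy n A B \<Y>) / (lam k - lam (k + 1))))"
proof -
  define L where "L = lower_rows k C"
  define s where "s = spectral_norm (L\<^sup>T * L)"
  define X where "X = mat_of_cols n (map x [1..<n + 1])"
  define Z where "Z = mat_of_cols n (map x [1..<k + 1])"
  \<comment> \<open>Shifted to indices from 0, so that \<open>d i\<close> belongs to column
    \<open>i\<close> of \<open>X\<close> and row \<open>i\<close> of \<open>C\<close>; thus
    \<open>d k\<close> is \<open>lam (k + 1)\<close>.\<close>
  define d where "d i = lam (i + 1)" for i
  have Ac[simp]: "A \<in> carrier_mat n n" and Bc[simp]: "B \<in> carrier_mat n n" and BT: "B\<^sup>T = B"
    using A B by (auto simp: spd_def)
  have Xc[simp]: "X \<in> carrier_mat n n" and Zc[simp]: "Z \<in> carrier_mat n k"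
    using mat_of_cols_carrier(1)[of n "map x [1..<n + 1]"] mat_of_cols_carrier(1)[of n "map x [1..<k + 1]"]
    by (simp_all add: X_def Z_def del: upt_Suc)
  note [simp] = carrier_matD[OF Xc] carrier_matD[OF Zc]
  have colX: "col X i = x (i + 1)" if "i < n" for i
    using that x_carrier[of "i + 1"] by (simp add: X_def col_mat_of_cols del: upt_Suc)
  have colZ: "col Z i = x (i + 1)" if "i < k" for i
    using that x_carrier[of "i + 1"] k by (simp add: Z_def col_mat_of_cols del: upt_Suc)
  have XBX: "X\<^sup>T * B * X = 1\<^sub>m n"
    by (rule eq_matI) (auto simp: gram_index[of _ n n] colX x_B simp del: index_mult_mat(1))
  have XAX: "X\<^sup>T * A * X = diag_of n d"
    by (rule eq_matI) (auto simp: gram_index[of _ n n] colX x_A d_def diag_of_def simp del: index_mult_mat(1))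
  have ZBZ: "Z\<^sup>T * B * Z = 1\<^sub>m k"
    using k by (intro eq_matI) (auto simp: gram_index[of _ n k] colZ x_B simp del: index_mult_mat(1))

  have antimono: "lam j \<le> lam i" if "1 \<le> i" "i \<le> j" "j \<le> n" for i j
    using that(2,3)
  proof (induction j rule: dec_induct)
    case (step m)
    then show ?case using ordered[of m] that(1) by simp
  qed simp
  have lam_pos: "lam (k + 1) > 0" using antimono[of "k + 1" n] k pos by simp

  have cols_Z: "set (cols Z) = x ` {1..k}"
  proof -
    have "cols Z = map x [1..<k + 1]"
      unfolding Z_def using k x_carrier by (intro cols_mat_of_cols) auto
    then show ?thesis by (simp add: atLeastLessThanSuc_atLeastAtMost del: upt_Suc)
  qed
  have Xh_sub: "is_subspace n Xh" and Z_basis: "orthonormal_basis_mat n B Xh Z"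
    unfolding Xh cols_Z[symmetric] using orthonormal_basis_mat_span[OF Bc Zc ZBZ] by auto
  have Xh_range: "Xh = {Z *\<^sub>v v | v. v \<in> carrier_vec k}"
    using orthonormal_basis_mat_range[OF Xh_sub Z_basis] by simp
  have Y_range: "\<Y> = {Y *\<^sub>v v | v. v \<in> carrier_vec k}"
    using orthonormal_basis_mat_range[OF \<Y>(1) Y(2)] by (simp add: carrier_matD(2)[OF Y(1)])

  have YXC: "Y = X * C" using C(2) by (simp add: X_def)
  \<comment> \<open>In eigenbasis coordinates, \<open>B\<close>-orthonormality of \<open>Y\<close>
    becomes ordinary orthonormality of the columns of \<open>C\<close>.\<close>
  have "Y\<^sup>T * B * Y = C\<^sup>T * C"
    unfolding YXC gram_mult[OF Xc Bc C(1)] XBX using C(1) by simp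
  then have CC: "C\<^sup>T * C = 1\<^sub>m k"
    using orthonormal_basis_mat_gram[OF Bc Y(2)] Y(1) by simp
  have "mat_trace (Y\<^sup>T * A * Y) = (\<Sum>i<n. d i * (row C i \<bullet> row C i))"
    unfolding YXC gram_mult[OF Xc Ac C(1)] XAX by (rule mat_trace_diag_of[OF C(1)])
  then have EY: "energy n A B \<Y> = (\<Sum>i<n. d i * (row C i \<bullet> row C i)) / k"
    using energy_eq[OF Bc BT Ac \<Y>(1) Y(2)] Y(1) by simp
  have "mat_trace (Z\<^sup>T * A * Z) = (\<Sum>i<k. d i)"
    unfolding mat_trace_def using k
    by (auto simp: gram_index[OF Zc Ac] colZ x_A d_def simp del: index_mult_mat(1)
        intro!: sum.cong)
  then have EX: "energy n A B Xh = (\<Sum>i<k. d i) / k"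
    using energy_eq[OF Bc BT Ac Xh_sub Z_basis] by simp

  have "C\<^sup>T * diag_of n (\<lambda>_. 1) * C = 1\<^sub>m k"
    using CC C(1) by (simp add: diag_of_def one_mat_def[symmetric])
  then have sum_rows: "(\<Sum>i<n. row C i \<bullet> row C i) = real k"
    using mat_trace_diag_of[OF C(1), of "\<lambda>_. 1"] by (simp add: mat_trace_def)

  \<comment> \<open>Multiplying by \<open>k\<close> undoes the averaging in the energies, so
    \<open>G\<close> is a difference of traces. The smallness hypothesis becomes
    \<open>G \<le> gp / 2\<close>.\<close>
  define G where "G = real k * (energy n A B Xh - energy n A B \<Y>)"
  define gp where "gp = lam k - lam (k + 1)"
  have gp: "gp > 0" using gap by (simp add: gp_def)
  have Lc: "L \<in> carrier_mat (n - k) k" unfolding L_def by (rule lower_rows_carrier[OF C(1)])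
  \<comment> \<open>\<open>sum_diff_weighted_ge\<close> with \<open>p = lam k\<close>,
    \<open>q = lam (k + 1)\<close> and the squared row norms of \<open>C\<close> as weights; those
    of the last rows add up to \<open>frobenius_sq L\<close>.\<close>
  have "gp * frobenius_sq L \<le> (\<Sum>i<k. d i) - (\<Sum>i<n. d i * (row C i \<bullet> row C i))"
    unfolding L_def frobenius_sq_lower_rows[OF C(1) less_imp_le[OF k(2)]] gp_def
    using k row_of_orthonormal_cols_le_1[OF C(1) CC] sum_rows
    by (intro sum_diff_weighted_ge) (auto simp: d_def scalar_prod_self_nonneg intro!: antimono)
  also have "\<dots> = G"
    using k by (simp add: G_def EX EY right_diff_distrib)
  finally have FG: "frobenius_sq L \<le> G / gp"
    using gp by (simp add: field_simps)
  have "G \<le> real k * (gp / (2 * real k))"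
    unfolding G_def gp_def by (intro mult_left_mono small) auto
  then have "G / gp \<le> 1 / 2" using k gp by (simp add: field_simps)
  have "s \<le> frobenius_sq L" unfolding s_def by (rule spectral_norm_gram_le[OF Lc])
  with FG \<open>G / gp \<le> 1 / 2\<close> have s: "0 \<le> s" "s \<le> 1 / 2" "s \<le> G / gp"
    using spectral_norm_gram_nonneg[OF Lc] unfolding s_def by linarith+

  have "kolmogorov_dist A B \<Y> Xh \<le> sqrt (lam (k + 1) * (s / (1 - s)))"
  proof (rule kolmogorov_dist_le[OF A])
    show "\<Y> \<subseteq> carrier_vec n" "Xh \<subseteq> carrier_vec n"
      unfolding Y_range Xh_range
      using mult_mat_vec_carrier[OF Y(1)] mult_mat_vec_carrier[OF Zc] by auto
    have "Z *\<^sub>v 0\<^sub>v k = 0\<^sub>v n" using Zc by auto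
    then show "0\<^sub>v n \<in> Xh" unfolding Xh_range by (auto intro!: exI[of _ "0\<^sub>v k"])
    fix z assume z: "z \<in> Xh" "weighted_norm B z \<le> 1"
    then obtain a where a: "a \<in> carrier_vec k" "z = Z *\<^sub>v a" unfolding Xh_range by auto
    \<comment> \<open>Padding \<open>a\<close> with zeros gives the coordinates of \<open>z\<close>
      in the full eigenbasis.\<close>
    define p where "p = vec n (\<lambda>i. if i < k then a $ i else 0)"
    have p: "p \<in> carrier_vec n" by (simp add: p_def)
    have zp: "z = X *\<^sub>v p"
    proof (rule eq_vecI)
      fix i assume "i < dim_vec (X *\<^sub>v p)"
      then have i: "i < n" by simp
      have ZX: "Z $$ (i, j) = X $$ (i, j)" if "j < k" for j
        using colX[of j] colZ[of j] that k i
        by (metis carrier_matD[OF Xc] carrier_matD[OF Zc] index_col less_trans)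
      have "z $ i = (\<Sum>j<k. X $$ (i, j) * a $ j)"
        using i a ZX by (simp add: scalar_prod_def atLeast0LessThan)
      also have "\<dots> = (\<Sum>j<n. X $$ (i, j) * p $ j)"
        using k by (intro sum.mono_neutral_cong_left) (auto simp: p_def)
      also have "\<dots> = (X *\<^sub>v p) $ i"
        using i p by (simp add: scalar_prod_def atLeast0LessThan)
      finally show "z $ i = (X *\<^sub>v p) $ i" .
    qed (use a in auto)
    have "a \<bullet> a = p \<bullet> p"
      unfolding scalar_prod_self_eq_sum[OF p] scalar_prod_self_eq_sum[OF a(1)]
      using k by (intro sum.mono_neutral_cong_left) (auto simp: p_def)
    also have "\<dots> = z \<bullet> (B *\<^sub>v z)"
      using quadratic_form_mult_mat_vec[OF Xc Bc p] p by (simp add: zp XBX)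
    finally have aa: "a \<bullet> a \<le> 1"
      using z(2) by (simp add: weighted_norm_def)
    have "spectral_norm ((lower_rows k C)\<^sup>T * lower_rows k C) < 1"
      using s by (simp add: s_def L_def)
    \<comment> \<open>The approximant is \<open>Y *\<^sub>v b\<close>. Its first \<open>k\<close>
      eigenbasis coordinates agree with those of \<open>z\<close>, so the error \<open>e\<close>
      vanishes there and only eigenvalues up to \<open>lam (k + 1)\<close> enter its
      \<open>A\<close>-norm.\<close>
    then obtain b where b: "b \<in> carrier_vec k" "\<And>i. i < k \<Longrightarrow> (C *\<^sub>v b) $ i = a $ i"
      "(1 - s) * (b \<bullet> b) \<le> a \<bullet> a" "(\<Sum>i=k..<n. ((C *\<^sub>v b) $ i)\<^sup>2) \<le> s * (b \<bullet> b)"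
      using orthonormal_cols_solve_upper_block[OF C(1) CC less_imp_le[OF k(2)] _ a(1)]
      by (auto simp: s_def L_def)
    have Cb: "C *\<^sub>v b \<in> carrier_vec n" using C(1) b(1) by simp
    define e where "e = p - C *\<^sub>v b"
    have e: "e \<in> carrier_vec n" using p Cb by (simp add: e_def)
    have ei: "e $ i = (if i < k then 0 else - (C *\<^sub>v b) $ i)" if "i < n" for i
      using that Cb b(2)[of i] carrier_vecD[OF Cb] by (simp add: e_def p_def del: index_mult_mat_vec)
    have "z - Y *\<^sub>v b = X *\<^sub>v e"
      using zp YXC p Cb C(1) b(1)
      by (simp add: e_def mult_minus_distrib_mat_vec[of _ n n] assoc_mult_mat_vec[of _ n n _ k])
    then have "(z - Y *\<^sub>v b) \<bullet> (A *\<^sub>v (z - Y *\<^sub>v b)) = (\<Sum>i<n. d i * (e $ i)\<^sup>2)"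
      using quadratic_form_mult_mat_vec[OF Xc Ac e] diag_of_quadratic_form[OF e] by (simp add: XAX)
    also have "\<dots> = (\<Sum>i=k..<n. d i * ((C *\<^sub>v b) $ i)\<^sup>2)"
      using ei by (intro sum.mono_neutral_cong_right) (auto simp del: index_mult_mat_vec)
    also have "\<dots> \<le> lam (k + 1) * (\<Sum>i=k..<n. ((C *\<^sub>v b) $ i)\<^sup>2)"
      unfolding sum_distrib_left d_def by (intro sum_mono mult_right_mono antimono) auto
    also have "\<dots> \<le> lam (k + 1) * (s * (b \<bullet> b))"
      using lam_pos b(4) by (intro mult_left_mono) auto
    also have "\<dots> \<le> lam (k + 1) * (s / (1 - s))"
    proof -
      \<comment> \<open>Combines \<open>(1 - s) * (b \<bullet> b) \<le> a \<bullet> a\<close> with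
        \<open>a \<bullet> a \<le> 1\<close>, the latter being the constraint on the
        \<open>B\<close>-norm of \<open>z\<close>.\<close>
      have "b \<bullet> b \<le> 1 / (1 - s)" using b(3) aa s by (simp add: field_simps)
      then have "s * (b \<bullet> b) \<le> s * (1 / (1 - s))" using s by (intro mult_left_mono) auto
      then show ?thesis using lam_pos by (intro mult_left_mono) auto
    qed
    finally show "\<exists>y\<in>\<Y>. weighted_norm A (z - y) \<le> sqrt (lam (k + 1) * (s / (1 - s)))"
      unfolding Y_range weighted_norm_def using b(1) by (auto intro!: real_sqrt_le_mono)
  qed simp
  moreover have "lam (k + 1) * (s / (1 - s)) \<le> 2 * lam (k + 1) * (G / gp)"
  proof -
    \<comment> \<open>The factor 2 of the second bound arises here: \<open>s \<le> 1 / 2\<close>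
      means \<open>1 - s \<ge> 1 / 2\<close>, so dividing by \<open>1 - s\<close> at most doubles
      \<open>s\<close>.\<close>
    have "s \<le> (2 * s) * (1 - s)"
      using mult_left_mono[OF s(2) s(1)] by (simp add: algebra_simps)
    then have "s / (1 - s) \<le> 2 * s" using s(2) by (simp add: divide_le_eq)
    also have "\<dots> \<le> 2 * (G / gp)" using s(3) by simp
    finally have "lam (k + 1) * (s / (1 - s)) \<le> lam (k + 1) * (2 * (G / gp))"
      using lam_pos by (intro mult_left_mono) auto
    then show ?thesis by (simp only: mult_ac)
  qed
  then have "sqrt (lam (k + 1) * (s / (1 - s))) \<le> sqrt (2 * lam (k + 1) * (G / gp))"
    by simp
  ultimately show ?thesis
    unfolding s_def L_def G_def gp_def by linarith
qed

end
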